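(* Let $k > 6$ be an even integer, let $y \geq 2$ be an integer, let $x$ be a positive integer with $x \neq 2$, and put $u = 4x$ and $g = ky$. Then there exists a $k$-ARCS of $(K_u \times K_g)(2)$.
   Context: For graphs $G,H$, the tensor product $G \times H$ has vertex set $V(G)\times V(H)$, with $(g_1,h_1)$ adjacent to $(g_2,h_2)$ iff $g_1g_2 \in E(G)$ and $h_1h_2 \in E(H)$. For a graph $G$ and positive integer $\lambda$, $G(\lambda)$ is the multigraph obtained by replacing each edge of $G$ by $\lambda$ parallel edges. $K_n$ is the complete graph on $n$ vertices. $(K_u \times K_g)(\lambda)$ is regarded as a $u$-partite multigraph with partite sets $V_i = \{i\}\times V(K_g)$, $i=1,\dots,u$. A partial $C_k$-factor of $(K_u \times K_g)(\lambda)$ is a subgraph which, for some $i$, is a spanning subgraph of $(K_u \times K_g)(\lambda)\setminus V_i$ all of whose components are cycles of length $k$. A $k$-ARCS of $(K_u \times K_g)(\lambda)$ is a partition of its edge multiset into partial $C_k$-factors. *)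

theory Defs
  imports Main "HOL-Library.Multiset"
begin

text \<open>
  Edges are two-element vertex sets. The edges of a multigraph form a multiset, in which the
  multiplicity of an edge is its number of parallel copies.
\<close>

record 'a graph =
  verts :: "'a set"
  edges :: "'a set set"

record 'a multigraph =
  mverts :: "'a set"
  medges :: "'a set multiset"

definition complete_graph :: "nat \<Rightarrow> nat graph" where
  "complete_graph n =
     \<lparr>verts = {1..n}, edges = {{a, b} | a b. a \<in> {1..n} \<and> b \<in> {1..n} \<and> a \<noteq> b}\<rparr>"

definition tensor_product :: "'a graph \<Rightarrow> 'b graph \<Rightarrow> ('a \<times> 'b) graph" where
  "tensor_product G H =
     \<lparr>verts = verts G \<times> verts H,
      edges = {{(g1, h1), (g2, h2)} | g1 h1 g2 h2. {g1, g2} \<in> edges G \<and> {h1, h2} \<in> edges H}\<rparr>"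

text \<open>This is \<open>G(\<lambda>)\<close>, for a graph with finitely many edges.\<close>

definition edge_multiple :: "'a graph \<Rightarrow> nat \<Rightarrow> 'a multigraph" where
  "edge_multiple G l =
     \<lparr>mverts = verts G, medges = repeat_mset l (mset_set (edges G))\<rparr>"

definition induced_subgraph :: "'a multigraph \<Rightarrow> 'a set \<Rightarrow> 'a multigraph" where
  "induced_subgraph M W =
     \<lparr>mverts = mverts M \<inter> W, medges = filter_mset (\<lambda>e. e \<subseteq> W) (medges M)\<rparr>"

definition delete_verts :: "'a multigraph \<Rightarrow> 'a set \<Rightarrow> 'a multigraph" where
  "delete_verts M W = induced_subgraph M (mverts M - W)"

definition subgraph :: "'a multigraph \<Rightarrow> 'a multigraph \<Rightarrow> bool" where
  "subgraph F M \<longleftrightarrow>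
     mverts F \<subseteq> mverts M \<and> medges F \<subseteq># medges M \<and> (\<forall>e \<in># medges F. e \<subseteq> mverts F)"

definition spanning_subgraph :: "'a multigraph \<Rightarrow> 'a multigraph \<Rightarrow> bool" where
  "spanning_subgraph F M \<longleftrightarrow> subgraph F M \<and> mverts F = mverts M"

definition connected_rel :: "'a multigraph \<Rightarrow> ('a \<times> 'a) set" where
  "connected_rel M = {(v, w). {v, w} \<in># medges M}\<^sup>* \<inter> mverts M \<times> mverts M"

definition components :: "'a multigraph \<Rightarrow> 'a multigraph set" where
  "components M = induced_subgraph M ` (mverts M // connected_rel M)"

definition is_cycle :: "nat \<Rightarrow> 'a multigraph \<Rightarrow> bool" where
  "is_cycle k C \<longleftrightarrow>
     (\<exists>vs. distinct vs \<and> length vs = k \<and> mverts C = set vs \<and>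
        medges C = {# {vs ! i, vs ! (Suc i mod k)}. i \<in># mset_set {..<k} #})"

definition KxK :: "nat \<Rightarrow> nat \<Rightarrow> nat \<Rightarrow> (nat \<times> nat) multigraph" where
  "KxK u g l = edge_multiple (tensor_product (complete_graph u) (complete_graph g)) l"

definition partite_set :: "nat \<Rightarrow> nat \<Rightarrow> (nat \<times> nat) set" where
  "partite_set g i = {i} \<times> verts (complete_graph g)"

definition partial_cycle_factor ::
    "nat \<Rightarrow> nat \<Rightarrow> nat \<Rightarrow> nat \<Rightarrow> (nat \<times> nat) multigraph \<Rightarrow> bool" where
  "partial_cycle_factor k u g l F \<longleftrightarrow>
     (\<exists>i \<in> {1..u}.
        spanning_subgraph F (delete_verts (KxK u g l) (partite_set g i)) \<and>
        (\<forall>C \<in> components F. is_cycle k C))"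

text \<open>
  The factors form a multiset, not a set: two factors that use different parallel copies of the
  same edges are equal as multigraphs.
\<close>

definition ARCS ::
    "nat \<Rightarrow> nat \<Rightarrow> nat \<Rightarrow> nat \<Rightarrow> (nat \<times> nat) multigraph multiset \<Rightarrow> bool" where
  "ARCS k u g l \<F> \<longleftrightarrow>
     (\<forall>F \<in># \<F>. partial_cycle_factor k u g l F) \<and>
     (\<Sum>F \<in># \<F>. medges F) = medges (KxK u g l)"

end

theory Submission
  imports Defs
begin

text \<open>
  Let \<open>\<pi>\<close> be an idempotent Latin square on the \<open>u\<close> partite sets: every \<open>\<pi> i\<close> permutes the indices other
  than \<open>i\<close>, and for \<open>a \<noteq> b\<close> there is exactly one \<open>i\<close> with \<open>\<pi> i a = b\<close>. A factor of \<open>K\<^sub>g(2)\<close> into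
  \<open>k\<close>-cycles \<open>v\<^sub>0 v\<^sub>1 v\<^sub>2 \<dots>\<close> and an index \<open>i\<close> give a partial factor missing \<open>V\<^sub>i\<close>, consisting of the
  cycles \<open>(a, v\<^sub>0) (\<pi> i a, v\<^sub>1) (a, v\<^sub>2) \<dots>\<close> for \<open>a \<noteq> i\<close>; these close up because \<open>k\<close> is even. Over all
  \<open>i\<close>, an edge \<open>pq\<close> of a cycle contributes every edge between \<open>(a, p)\<close> and \<open>(b, q)\<close> with \<open>a \<noteq> b\<close>
  exactly once, so a \<open>C\<^sub>k\<close>-factorization of \<open>K\<^sub>g(2)\<close> yields the required \<open>k\<close>-ARCS.

  For such a factorization with \<open>k = 2n\<close> and \<open>g = ky\<close>, blow up a 1-factorization of \<open>K\<^bsub>2y\<^esub>\<close> by \<open>n\<close>.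
  In one 1-factor, each edge becomes a \<open>K\<^bsub>2n\<^esub>(2)\<close>, in the others a \<open>K\<^bsub>n,n\<^esub>(2)\<close>; both have Hamiltonian
  decompositions.
\<close>

section \<open>Cycle decompositions\<close>

definition pairs :: "'a set \<Rightarrow> 'a set set" where
  "pairs V = {{a, b} | a b. a \<in> V \<and> b \<in> V \<and> a \<noteq> b}"

definition cyc_edges :: "nat \<Rightarrow> (nat \<Rightarrow> 'a) \<Rightarrow> 'a set multiset" where
  "cyc_edges k v = (\<Sum>j<k. {#{v j, v (Suc j mod k)}#})"

text \<open>\<open>N\<close> counts factors, \<open>S\<close> the cycles of a factor;
  \<open>\<Phi> t s j\<close> is vertex \<open>j\<close> of cycle \<open>s\<close> in factor
  \<open>t\<close>. For finite \<open>V\<close>, the equation with \<open>mset_set V\<close> says at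
  once that each cycle has distinct vertices and that the cycles of a factor are disjoint and cover
  \<open>V\<close>.\<close>

definition cycle_decomp :: "nat \<Rightarrow> nat \<Rightarrow> nat \<Rightarrow> 'a set \<Rightarrow> 'a set multiset \<Rightarrow> bool" where
  "cycle_decomp N S k V E \<longleftrightarrow>
     (\<exists>\<Phi>. (\<forall>t<N. (\<Sum>s<S. \<Sum>j<k. {#\<Phi> t s j#}) = mset_set V) \<and>
          (\<Sum>t<N. \<Sum>s<S. cyc_edges k (\<Phi> t s)) = E)"

section \<open>Multisets of images and of pairs\<close>

lemma sum_singleton_image: "(\<Sum>x\<in>A. {#f x#}) = image_mset f (mset_set A)"
  by (induction A rule: infinite_finite_induct) auto

text \<open>A surjection between finite sets of equal size is injective. The zigzag lemmas thus need
  only surjectivity and a count.\<close>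

lemma image_mset_eq_mset_setI:
  assumes "finite A" "f ` A = B" "card A = card B"
  shows "image_mset f (mset_set A) = mset_set B"
  using assms by (metis eq_card_imp_inj_on image_mset_mset_set)

lemma image_mset_eq_mset_setD:
  assumes "finite A" "finite B" "image_mset f (mset_set A) = mset_set B"
  shows "f ` A = B" "inj_on f A"
proof -
  show *: "f ` A = B"
    using assms by (metis finite_set_mset_mset_set set_image_mset)
  have "card A = card B"
    using assms by (metis size_image_mset size_mset_set)
  with * show "inj_on f A"
    using assms eq_card_imp_inj_on by metis
qed

lemma sum_image_mset: "(\<Sum>x\<in>A. image_mset f (M x)) = image_mset f (\<Sum>x\<in>A. M x)"
  by (induction A rule: infinite_finite_induct) auto

lemma mset_set_fibers:
  assumes "finite A" "finite B" "f ` A \<subseteq> B"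
  shows "(\<Sum>b\<in>B. mset_set {a \<in> A. f a = b}) = mset_set A"
proof (rule multiset_eqI)
  fix x
  have "count (\<Sum>b\<in>B. mset_set {a \<in> A. f a = b}) x = (\<Sum>b\<in>B. if x \<in> A \<and> f x = b then 1 else 0)"
    using assms by (auto simp: count_sum count_mset_set' intro!: sum.cong)
  also have "\<dots> = (if x \<in> A then 1 else 0)"
    using assms by (cases "x \<in> A") auto
  finally show "count (\<Sum>b\<in>B. mset_set {a \<in> A. f a = b}) x = count (mset_set A) x"
    using assms by (simp add: count_mset_set')
qed

lemma pairs_eq: "pairs V = {e. e \<subseteq> V \<and> card e = 2}"
  by (auto simp: pairs_def card_2_iff)

lemma finite_pairs [simp]: "finite V \<Longrightarrow> finite (pairs V)"
  by (simp add: pairs_eq)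

lemma card_pairs: "finite V \<Longrightarrow> card (pairs V) = card V * (card V - 1) div 2"
  by (simp add: pairs_eq n_subsets choose_two)

lemma inj_on_image_pairs: "inj_on f V \<Longrightarrow> inj_on ((`) f) (pairs V)"
  by (rule inj_on_subset[OF inj_on_image_Pow]) (auto simp: pairs_eq)

lemma image_pairs:
  assumes "inj_on f V"
  shows "(`) f ` pairs V = pairs (f ` V)"
proof
  show "(`) f ` pairs V \<subseteq> pairs (f ` V)"
    using assms by (auto simp: pairs_def inj_on_def)
  show "pairs (f ` V) \<subseteq> (`) f ` pairs V"
  proof
    fix e assume "e \<in> pairs (f ` V)"
    then obtain a b where "e = f ` {a, b}" "a \<in> V" "b \<in> V" "a \<noteq> b"
      by (auto simp: pairs_def)
    then show "e \<in> (`) f ` pairs V"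
      unfolding pairs_def by blast
  qed
qed

lemma sum_even_odd: "(\<Sum>i<2 * n. F i) = (\<Sum>j<n. F (2 * j)) + (\<Sum>j<n. F (Suc (2 * j)))"
  for F :: "nat \<Rightarrow> 'a::comm_monoid_add"
  by (induction n) (simp_all add: algebra_simps)

definition alternate :: "(nat \<Rightarrow> 'a) \<Rightarrow> (nat \<Rightarrow> 'a) \<Rightarrow> nat \<Rightarrow> 'a" where
  "alternate f h i = (if even i then f (i div 2) else h (i div 2))"

lemma sum_alternate:
  "(\<Sum>i<2 * n. {#alternate f h i#}) = (\<Sum>j<n. {#f j#}) + (\<Sum>j<n. {#h j#})"
  by (simp add: sum_even_odd alternate_def)

lemma cyc_edges_alternate:
  "cyc_edges (2 * n) (alternate f h) =
     (\<Sum>j<n. {#{f j, h j}#}) + (\<Sum>j<n. {#{h j, f (Suc j mod n)}#})"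
proof -
  \<comment> \<open>After the odd position \<open>2 * j + 1\<close> comes position
    \<open>2 * (Suc j mod n)\<close>, also at the wraparound.\<close>
  have "Suc (Suc (2 * j)) mod (2 * n) = 2 * (Suc j mod n)" for j
    by (metis mult_Suc_right mult_mod_right add_2_eq_Suc)
  then show ?thesis
    unfolding cyc_edges_def sum_even_odd
    by (intro arg_cong2[of _ _ _ _ "(+)"] sum.cong) (simp_all add: alternate_def)
qed

section \<open>Transport and combination of cycle decompositions\<close>

lemma cycle_decomp_image:
  assumes "cycle_decomp N S k V E" "inj_on f V"
  shows "cycle_decomp N S k (f ` V) (image_mset ((`) f) E)"
proof -
  obtain \<Phi> where v: "\<And>t. t < N \<Longrightarrow> (\<Sum>s<S. \<Sum>j<k. {#\<Phi> t s j#}) = mset_set V"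
    and e: "(\<Sum>t<N. \<Sum>s<S. cyc_edges k (\<Phi> t s)) = E"
    using assms by (auto simp: cycle_decomp_def)
  have "(\<Sum>s<S. \<Sum>j<k. {#f (\<Phi> t s j)#}) = mset_set (f ` V)" if "t < N" for t
    using arg_cong[OF v[OF that], of "image_mset f"] assms(2)
    by (simp add: image_mset_mset_set flip: sum_image_mset)
  moreover have "(\<Sum>t<N. \<Sum>s<S. cyc_edges k (\<lambda>j. f (\<Phi> t s j))) = image_mset ((`) f) E"
    unfolding e[symmetric] by (simp add: cyc_edges_def flip: sum_image_mset)
  ultimately show ?thesis
    unfolding cycle_decomp_def by (intro exI[of _ "\<lambda>t s j. f (\<Phi> t s j)"]) auto
qed

lemma cycle_decomp_add:
  assumes "cycle_decomp N S k V E" "cycle_decomp N' S k V E'"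
  shows "cycle_decomp (N + N') S k V (E + E')"
proof -
  obtain \<Phi> \<Psi> where v: "\<And>t. t < N \<Longrightarrow> (\<Sum>s<S. \<Sum>j<k. {#\<Phi> t s j#}) = mset_set V"
      "\<And>t. t < N' \<Longrightarrow> (\<Sum>s<S. \<Sum>j<k. {#\<Psi> t s j#}) = mset_set V"
    and e: "(\<Sum>t<N. \<Sum>s<S. cyc_edges k (\<Phi> t s)) = E" "(\<Sum>t<N'. \<Sum>s<S. cyc_edges k (\<Psi> t s)) = E'"
    using assms unfolding cycle_decomp_def by metis
  have split: "(\<Sum>t<N + N'. F t) = (\<Sum>t<N. F t) + (\<Sum>t<N'. F (N + t))" for F :: "nat \<Rightarrow> 'a set multiset"
    by (induction N') (simp_all add: algebra_simps)
  define \<Xi> where "\<Xi> t = (if t < N then \<Phi> t else \<Psi> (t - N))" for t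
  have "(\<Sum>s<S. \<Sum>j<k. {#\<Xi> t s j#}) = mset_set V" if "t < N + N'" for t
    using that v by (simp add: \<Xi>_def)
  moreover have "(\<Sum>t<N + N'. \<Sum>s<S. cyc_edges k (\<Xi> t s)) = E + E'"
    unfolding split e[symmetric] by (simp add: \<Xi>_def)
  ultimately show ?thesis
    unfolding cycle_decomp_def by blast
qed

lemma cycle_decomp_sum:
  assumes "\<And>r. r < R \<Longrightarrow> cycle_decomp N S k V (E r)"
  shows "cycle_decomp (R * N) S k V (\<Sum>r<R. E r)"
  using assms
proof (induction R)
  case 0
  then show ?case by (simp add: cycle_decomp_def)
next
  case (Suc R)
  then show ?case
    using cycle_decomp_add[of "R * N" S k V "\<Sum>r<R. E r" N "E R"] by (simp add: add.commute)
qed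

text \<open>The \<open>t\<close>-th cycles of the \<open>S\<close> blocks together form the
  \<open>t\<close>-th factor, so all blocks must supply the same number \<open>N\<close> of cycles.
  For finite sets, the second assumption says that the blocks partition \<open>U\<close>.\<close>

lemma cycle_decomp_parallel:
  assumes "\<And>s. s < S \<Longrightarrow> cycle_decomp N 1 k (V s) (E s)"
    and "(\<Sum>s<S. mset_set (V s)) = mset_set U"
  shows "cycle_decomp N S k U (\<Sum>s<S. E s)"
proof -
  have "\<forall>s\<in>{..<S}. \<exists>\<Phi>. (\<forall>t<N. (\<Sum>j<k. {#\<Phi> t 0 j#}) = mset_set (V s)) \<and>
      (\<Sum>t<N. cyc_edges k (\<Phi> t 0)) = E s"
    using assms(1) by (fastforce simp: cycle_decomp_def)
  then obtain \<Phi> where v: "\<And>s t. s < S \<Longrightarrow> t < N \<Longrightarrow> (\<Sum>j<k. {#\<Phi> s t (0::nat) j#}) = mset_set (V s)"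
    and e: "\<And>s. s < S \<Longrightarrow> (\<Sum>t<N. cyc_edges k (\<Phi> s t 0)) = E s"
    by (subst (asm) bchoice_iff) auto
  have "(\<Sum>s<S. \<Sum>j<k. {#\<Phi> s t 0 j#}) = mset_set U" if "t < N" for t
    using v that assms(2) by simp
  moreover have "(\<Sum>t<N. \<Sum>s<S. cyc_edges k (\<Phi> s t 0)) = (\<Sum>s<S. E s)"
    by (subst sum.swap) (simp add: e)
  ultimately show ?thesis
    unfolding cycle_decomp_def by (intro exI[of _ "\<lambda>t s. \<Phi> s t 0"]) auto
qed

lemma repeat_mset_2: "repeat_mset 2 M = M + M"
  by (simp add: multiset_eq_iff)

text \<open>The edges of an even cycle fall alternately into two classes. If over all cycles each
  class alone sums to \<open>E\<close>, both give \<open>E\<close> twice; this is where the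
  multiplicity 2 comes from.\<close>

lemma cycle_decomp_alternate:
  assumes "\<And>t. t < N \<Longrightarrow> (\<Sum>j<n. {#f t j#}) + (\<Sum>j<n. {#h t j#}) = mset_set V"
    and "(\<Sum>t<N. \<Sum>j<n. {#{f t j, h t j}#}) = E"
    and "(\<Sum>t<N. \<Sum>j<n. {#{h t j, f t (Suc j mod n)}#}) = E"
  shows "cycle_decomp N 1 (2 * n) V (repeat_mset 2 E)"
  unfolding cycle_decomp_def
  by (rule exI[of _ "\<lambda>t s. alternate (f t) (h t)"])
     (simp add: assms sum_alternate cyc_edges_alternate sum.distrib repeat_mset_2)

section \<open>Hamiltonian decomposition of the doubled complete graph\<close>

text \<open>The walk \<open>0, 1, -1, 2, -2, \<dots>\<close> modulo the odd number \<open>m\<close>, closed up through the point \<open>m\<close>,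
  which plays the role of infinity.\<close>

definition zig :: "nat \<Rightarrow> nat \<Rightarrow> nat \<Rightarrow> int" where
  "zig n r j = (int r - int j) mod (2 * int n - 1)"

definition zag :: "nat \<Rightarrow> nat \<Rightarrow> nat \<Rightarrow> int" where
  "zag n r j = (if Suc j < n then (int r + int j + 1) mod (2 * int n - 1) else 2 * int n - 1)"

lemma zigzag_verts:
  assumes "n > 0"
  shows "(\<Sum>j<n. {#zig n r j#}) + (\<Sum>j<n. {#zag n r j#}) = mset_set {0..2 * int n - 1}"
proof -
  define m where "m = 2 * int n - 1"
  define v where "v = alternate (zig n r) (zag n r)"
  have m: "m > 0" using assms by (simp add: m_def)
  have "v ` {..<2 * n} = {0..m}"
  proof
    show "v ` {..<2 * n} \<subseteq> {0..m}"
      using m by (auto simp: v_def alternate_def zig_def zag_def simp flip: m_def intro!: less_imp_le[OF pos_mod_bound])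
    show "{0..m} \<subseteq> v ` {..<2 * n}"
    proof
      fix w assume w: "w \<in> {0..m}"
      have vz: "zig n r j \<in> v ` {..<2 * n}" if "j < n" for j
        using that by (intro image_eqI[of _ _ "2 * j"]) (auto simp: v_def alternate_def)
      have va: "zag n r j \<in> v ` {..<2 * n}" if "j < n" for j
        using that by (intro image_eqI[of _ _ "Suc (2 * j)"]) (auto simp: v_def alternate_def)
      \<comment> \<open>\<open>d\<close> is the offset of \<open>w\<close> from the start
        \<open>r\<close>: offset 0 is \<open>zig\<close> at 0, offsets 1 to \<open>n - 1\<close> are
        \<open>zag\<close> at \<open>d - 1\<close>, larger ones \<open>zig\<close> at
        \<open>m - d\<close>.\<close>
      define d where "d = (w - int r) mod m"
      have d: "0 \<le> d" "d < m" using m by (auto simp: d_def)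
      consider "w = m" | "w < m" "d = 0" | "w < m" "0 < d" "d < int n" | "w < m" "d \<ge> int n"
        using w d by force
      then show "w \<in> v ` {..<2 * n}"
      proof cases
        case 1
        then show ?thesis using va[of "n - 1"] assms by (simp add: zag_def m_def)
      next
        case 2
        then have "zig n r 0 = w"
          using w by (simp add: zig_def d_def flip: m_def) (metis mod_eq_dvd_iff mod_pos_pos_trivial dvd_eq_mod_eq_0)
        then show ?thesis using vz[of 0] assms by simp
      next
        case 3
        have "zag n r (nat (d - 1)) = (int r + d) mod m"
          using 3 by (auto simp: zag_def m_def)
        also have "\<dots> = w" using w 3 by (simp add: d_def mod_simps)
        finally show ?thesis using va[of "nat (d - 1)"] 3 by auto
      next
        case 4
        have "zig n r (nat (m - d)) = (int r + d - m) mod m"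
          using d unfolding zig_def m_def[symmetric] by (simp add: algebra_simps)
        also have "\<dots> = w" using w 4 by (simp add: d_def mod_simps)
        finally show ?thesis using vz[of "nat (m - d)"] 4 d by (auto simp: m_def)
      qed
    qed
  qed
  then have "image_mset v (mset_set {..<2 * n}) = mset_set {0..m}"
    by (intro image_mset_eq_mset_setI) (auto simp: m_def)
  then show ?thesis
    unfolding v_def sum_singleton_image[symmetric] sum_alternate m_def .
qed

text \<open>There are \<open>(2 * n - 1) * n\<close> index pairs and equally many edges on
  \<open>2 * n\<close> points, so hitting every edge means hitting it exactly once.\<close>

lemma sum_sum_eq_pairs:
  fixes e :: "nat \<Rightarrow> nat \<Rightarrow> int set"
  assumes "n > 0"
    and "\<And>r j. r < 2 * n - 1 \<Longrightarrow> j < n \<Longrightarrow> e r j \<in> pairs {0..2 * int n - 1}"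
    and "\<And>a b. 0 \<le> a \<Longrightarrow> a < b \<Longrightarrow> b \<le> 2 * int n - 1 \<Longrightarrow> \<exists>r<2 * n - 1. \<exists>j<n. e r j = {a, b}"
  shows "(\<Sum>r<2 * n - 1. \<Sum>j<n. {#e r j#}) = mset_set (pairs {0..2 * int n - 1})"
proof -
  have "(\<lambda>(r, j). e r j) ` ({..<2 * n - 1} \<times> {..<n}) = pairs {0..2 * int n - 1}"
  proof
    show "pairs {0..2 * int n - 1} \<subseteq> (\<lambda>(r, j). e r j) ` ({..<2 * n - 1} \<times> {..<n})"
    proof
      fix x assume "x \<in> pairs {0..2 * int n - 1}"
      then obtain a b where "x = {a, b}" "0 \<le> a" "a < b" "b \<le> 2 * int n - 1"
        unfolding pairs_def by (force simp: insert_commute neq_iff)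
      with assms(3)[of a b] show "x \<in> (\<lambda>(r, j). e r j) ` ({..<2 * n - 1} \<times> {..<n})"
        by fastforce
    qed
  qed (use assms(2) in auto)
  then have "image_mset (\<lambda>(r, j). e r j) (mset_set ({..<2 * n - 1} \<times> {..<n})) = mset_set (pairs {0..2 * int n - 1})"
    by (intro image_mset_eq_mset_setI) (auto simp: card_pairs nat_mult_distrib)
  then show ?thesis
    unfolding sum.cartesian_product sum_singleton_image[symmetric]
    by (simp add: case_prod_unfold)
qed

text \<open>Edge \<open>j < n - 1\<close> joins residues at difference \<open>2 * j + 1\<close>, the
  last one leads to infinity. As \<open>m\<close> is odd, exactly one of the two cyclic distances of
  a pair of residues is odd, so the rotations by \<open>r\<close> meet every pair once.\<close>

lemma zig_zag_pairs:
  assumes "n > 0"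
  shows "(\<Sum>r<2 * n - 1. \<Sum>j<n. {#{zig n r j, zag n r j}#}) = mset_set (pairs {0..2 * int n - 1})"
proof (rule sum_sum_eq_pairs[OF assms])
  define m where "m = 2 * int n - 1"
  have m: "m > 0" using assms by (simp add: m_def)
  show "{zig n r j, zag n r j} \<in> pairs {0..2 * int n - 1}" if j: "j < n" for r j
  proof -
    have "(int r - int j) mod m \<noteq> (int r + int j + 1) mod m" if "Suc j < n"
    proof
      assume "(int r - int j) mod m = (int r + int j + 1) mod m"
      then have "m dvd (int r + int j + 1) - (int r - int j)"
        by (metis mod_eq_dvd_iff)
      then have "m \<le> 2 * int j + 1" by (intro zdvd_imp_le) (auto simp: algebra_simps)
      then show False using that by (simp add: m_def)
    qed
    moreover have "z mod m < m" "0 \<le> z mod m" for z using m by auto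
    ultimately have "zig n r j \<in> {0..m}" "zag n r j \<in> {0..m}" "zig n r j \<noteq> zag n r j"
      using m by (auto simp: zig_def zag_def simp flip: m_def intro: less_imp_le dest: less_imp_neq[OF pos_mod_bound])
    then show ?thesis
      unfolding pairs_def m_def by blast
  qed
  show "\<exists>r<2 * n - 1. \<exists>j<n. {zig n r j, zag n r j} = {a, b}"
    if ab: "0 \<le> a" "a < b" "b \<le> 2 * int n - 1" for a b
  proof -
    have *: "\<exists>r<2 * n - 1. \<exists>i<n. {zig n r i, zag n r i} = {c mod m, (c + 2 * int j + 1) mod m}"
      if "Suc j < n" for j c
    proof (intro exI conjI)
      \<comment> \<open>\<open>zig\<close> at \<open>j\<close> is \<open>r - j\<close>, which is
        \<open>c\<close> for the rotation \<open>r = c + j\<close>.\<close>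
      let ?r = "nat ((c + int j) mod m)"
      show "?r < 2 * n - 1" using m pos_mod_bound[OF m, of "c + int j"] by (simp add: m_def nat_less_iff)
      show "j < n" using that by simp
      have "zig n ?r j = c mod m"
        using m that unfolding zig_def m_def[symmetric] by (simp add: mod_simps)
      moreover have "zag n ?r j = ((c + int j) mod m + (int j + 1)) mod m"
        using m that unfolding zag_def m_def[symmetric] by (simp add: add.assoc)
      ultimately show "{zig n ?r j, zag n ?r j} = {c mod m, (c + 2 * int j + 1) mod m}"
        unfolding mod_add_left_eq by (simp add: algebra_simps)
    qed
    consider "b = m" | j where "b < m" "b - a = 2 * int j + 1" | j where "b < m" "a + m - b = 2 * int j + 1"
    proof -
      have "odd (b - a) \<or> odd (a + m - b)" by (auto simp: m_def)
      then show thesis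
      proof
        assume "odd (b - a)"
        then obtain i where "b - a = 2 * i + 1" by (rule oddE)
        then show thesis using that(2)[of "nat i"] that(1) ab by (cases "b = m") (auto simp: m_def)
      next
        assume "odd (a + m - b)"
        then obtain i where "a + m - b = 2 * i + 1" by (rule oddE)
        then show thesis using that(3)[of "nat i"] that(1) ab by (cases "b = m") (auto simp: m_def)
      qed
    qed
    then show ?thesis
    proof cases
      case 1
      define r where "r = nat ((a + int (n - 1)) mod m)"
      have "r < 2 * n - 1" using m pos_mod_bound[OF m, of "a + int (n - 1)"] by (simp add: m_def nat_less_iff r_def)
      moreover have "zig n r (n - 1) = a"
        using m ab 1 by (simp add: zig_def r_def mod_simps flip: m_def)
      ultimately show ?thesis
        using assms 1 by (intro exI[of _ r] conjI exI[of _ "n - 1"]) (auto simp: zag_def m_def)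
    next
      case (2 j)
      have "a + 2 * int j + 1 = b" using 2 by simp
      then have "(a + 2 * int j + 1) mod m = b" "a mod m = a" using ab 2 by simp_all
      moreover have "Suc j < n" using ab 2 by (simp add: m_def)
      ultimately show ?thesis using *[of j a] by simp
    next
      case (3 j)
      have e: "b + 2 * int j + 1 = a + m" using 3 by simp
      have "(b + 2 * int j + 1) mod m = a" unfolding e using ab 3 by simp
      then show ?thesis using *[of j b] ab 3 by (simp add: m_def insert_commute)
    qed
  qed
qed

text \<open>The complementary class has the even differences \<open>2 * j + 2\<close>, and each pair
  of residues has exactly one even cyclic distance. Infinity is joined to \<open>zig\<close> at 0,
  because \<open>Suc (n - 1) mod n = 0\<close>.\<close>

lemma zag_zig_pairs:
  assumes "n > 0"
  shows "(\<Sum>r<2 * n - 1. \<Sum>j<n. {#{zag n r j, zig n r (Suc j mod n)}#}) = mset_set (pairs {0..2 * int n - 1})"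
proof (rule sum_sum_eq_pairs[OF assms])
  define m where "m = 2 * int n - 1"
  have m: "m > 0" using assms by (simp add: m_def)
  show "{zag n r j, zig n r (Suc j mod n)} \<in> pairs {0..2 * int n - 1}" if j: "j < n" for r j
  proof -
    have "(int r - int (Suc j)) mod m \<noteq> (int r + int j + 1) mod m" if "Suc j < n"
    proof
      assume "(int r - int (Suc j)) mod m = (int r + int j + 1) mod m"
      then have "m dvd (int r + int j + 1) - (int r - int (Suc j))"
        by (metis mod_eq_dvd_iff)
      then have "m \<le> 2 * int j + 2" by (intro zdvd_imp_le) (auto simp: algebra_simps)
      then show False using that by (simp add: m_def)
    qed
    moreover have "z mod m < m" "0 \<le> z mod m" for z using m by auto
    moreover have "Suc j < n \<Longrightarrow> Suc j mod n = Suc j" by simp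
    ultimately have "zig n r (Suc j mod n) \<in> {0..m}" "zag n r j \<in> {0..m}" "zig n r (Suc j mod n) \<noteq> zag n r j"
      using m by (auto simp: zig_def zag_def simp flip: m_def intro: less_imp_le dest: less_imp_neq[OF pos_mod_bound])
    then show ?thesis
      unfolding pairs_def m_def by blast
  qed
  show "\<exists>r<2 * n - 1. \<exists>j<n. {zag n r j, zig n r (Suc j mod n)} = {a, b}"
    if ab: "0 \<le> a" "a < b" "b \<le> 2 * int n - 1" for a b
  proof -
    have *: "\<exists>r<2 * n - 1. \<exists>i<n. {zag n r i, zig n r (Suc i mod n)} = {c mod m, (c + 2 * int j + 2) mod m}"
      if "Suc j < n" for j c
    proof (intro exI conjI)
      let ?r = "nat ((c + int j + 1) mod m)"
      show "?r < 2 * n - 1" using m pos_mod_bound[OF m, of "c + int j + 1"] by (simp add: m_def nat_less_iff)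
      show "j < n" using that by simp
      have "zig n ?r (Suc j mod n) = c mod m"
        using m that unfolding zig_def m_def[symmetric] by (simp add: mod_simps)
      moreover have "zag n ?r j = ((c + int j + 1) mod m + (int j + 1)) mod m"
        using m that unfolding zag_def m_def[symmetric] by (simp add: add.assoc)
      ultimately show "{zag n ?r j, zig n ?r (Suc j mod n)} = {c mod m, (c + 2 * int j + 2) mod m}"
        unfolding mod_add_left_eq by (simp add: insert_commute algebra_simps)
    qed
    consider "b = m" | j where "b < m" "b - a = 2 * int j + 2" | j where "b < m" "a + m - b = 2 * int j + 2"
    proof -
      have "even (b - a) \<or> even (a + m - b)" by (auto simp: m_def)
      then show thesis
      proof
        assume "even (b - a)"
        then obtain i where "b - a = 2 * i" by (rule evenE)
        moreover have "i > 0" using ab calculation by simp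
        then obtain j where "i = int j + 1"
          by (metis pos_int_cases Suc_pred of_nat_Suc add.commute)
        ultimately show thesis using that(2)[of j] that(1) ab by (cases "b = m") (auto simp: m_def)
      next
        assume "even (a + m - b)"
        then obtain i where i: "a + m - b = 2 * i" by (rule evenE)
        show thesis
        proof (cases "b = m")
          case False
          then have "i > 0" using ab i by (simp add: m_def)
          then obtain j where "i = int j + 1"
            by (metis pos_int_cases Suc_pred of_nat_Suc add.commute)
          then show thesis using that(3)[of j] ab i False by (auto simp: m_def)
        qed (rule that(1))
      qed
    qed
    then show ?thesis
    proof cases
      case 1
      then have "zig n (nat a) 0 = a" "nat a < 2 * n - 1"
        using ab by (auto simp: zig_def m_def nat_less_iff)
      then show ?thesis
        using assms 1 by (intro exI[of _ "nat a"] conjI exI[of _ "n - 1"]) (auto simp: zag_def m_def)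
    next
      case (2 j)
      have "a + 2 * int j + 2 = b" using 2 by simp
      then have "(a + 2 * int j + 2) mod m = b" "a mod m = a" using ab 2 by simp_all
      moreover have "Suc j < n" using ab 2 by (simp add: m_def)
      ultimately show ?thesis using *[of j a] by simp
    next
      case (3 j)
      have e: "b + 2 * int j + 2 = a + m" using 3 by simp
      have "(b + 2 * int j + 2) mod m = a" unfolding e using ab 3 by simp
      then show ?thesis using *[of j b] ab 3 by (simp add: m_def insert_commute)
    qed
  qed
qed

lemma cycle_decomp_complete:
  assumes "finite V" "card V = 2 * n" "n > 0"
  shows "cycle_decomp (2 * n - 1) 1 (2 * n) V (repeat_mset 2 (mset_set (pairs V)))"
proof -
  let ?W = "{0..2 * int n - 1}"
  have "card ?W = card V" using assms by simp
  then obtain f where f: "bij_betw f ?W V"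
    using assms(1) by (metis bij_betw_iff_card finite_atLeastAtMost_int)
  have "cycle_decomp (2 * n - 1) 1 (2 * n) ?W (repeat_mset 2 (mset_set (pairs ?W)))"
    using assms(3) by (intro cycle_decomp_alternate[where f = "zig n" and h = "zag n"])
      (simp_all only: zigzag_verts zig_zag_pairs zag_zig_pairs)
  from cycle_decomp_image[OF this bij_betw_imp_inj_on[OF f]] show ?thesis
    using f by (simp add: bij_betw_def image_mset_mset_set inj_on_image_pairs image_pairs repeat_mset_2)
qed

section \<open>Blowing up a 1-factorization\<close>

lemma sum_rotate: "(\<Sum>d<n. F ((j + d) mod n)) = (\<Sum>q<n. F q)"
  for F :: "nat \<Rightarrow> 'a::comm_monoid_add"
proof (rule sum.reindex_bij_betw)
  have surj: "(\<lambda>d. (j + d) mod n) ` {..<n} = {..<n}"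
  proof
    show "{..<n} \<subseteq> (\<lambda>d. (j + d) mod n) ` {..<n}"
    proof
      fix w assume w: "w \<in> {..<n}"
      \<comment> \<open>The preimage of \<open>w\<close> is \<open>w - j\<close> modulo
        \<open>n\<close>, written so as to avoid truncated subtraction.\<close>
      have "(j + (w + (n - j mod n)) mod n) mod n = (j mod n + (w + (n - j mod n))) mod n"
        by (simp add: mod_simps)
      also have "j mod n + (w + (n - j mod n)) = w + n"
        using w mod_less_divisor[of n j] by (auto simp del: mod_less_divisor)
      finally have "(j + (w + (n - j mod n)) mod n) mod n = w" using w by simp
      then show "w \<in> (\<lambda>d. (j + d) mod n) ` {..<n}"
        using w by (intro image_eqI[of _ _ "(w + (n - j mod n)) mod n"]) auto
    qed
  qed (auto intro: mod_less_divisor)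
  then show "bij_betw (\<lambda>d. (j + d) mod n) {..<n} {..<n}"
    by (simp add: bij_betw_def eq_card_imp_inj_on)
qed

lemma sum_mset_image_sum:
  "\<Sum>\<^sub># (image_mset G (\<Sum>x\<in>X. M x)) = (\<Sum>x\<in>X. \<Sum>\<^sub># (image_mset G (M x)))"
  by (induction X rule: infinite_finite_induct) auto

text \<open>For finite \<open>C\<close>, the family \<open>f\<close> lists each element of
  \<open>C\<close> once, so it reindexes any sum. This carries the 1-factorization identities over
  to sums of block edges.\<close>

lemma sum_sum_of_mset_eq:
  assumes "(\<Sum>r\<in>A. \<Sum>s\<in>B. {#f r s#}) = mset_set C"
  shows "(\<Sum>r\<in>A. \<Sum>s\<in>B. G (f r s)) = sum G C"
  using arg_cong[OF assms, of "\<lambda>M. \<Sum>\<^sub># (image_mset G M)"]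
  by (simp add: sum_mset_image_sum sum_unfold_sum_mset[of G C])

text \<open>For \<open>e = {a, b}\<close> with distinct ends these are the edges between the blocks
  over \<open>a\<close> and \<open>b\<close>, a complete bipartite graph; for \<open>e = {a}\<close>
  they are the edges inside one block.\<close>

definition block_edges :: "nat \<Rightarrow> 'a set \<Rightarrow> ('a \<times> nat) set set" where
  "block_edges n e = {x \<in> pairs (e \<times> {..<n}). fst ` x = e}"

lemma block_edges_eq: "e \<subseteq> W \<Longrightarrow> {x \<in> pairs (W \<times> {..<n}). fst ` x = e} = block_edges n e"
  unfolding block_edges_def pairs_def by fastforce

lemma mset_set_pairs_times:
  assumes "finite W"
  shows "mset_set (pairs (W \<times> {..<n})) =
    (\<Sum>e\<in>pairs W. mset_set (block_edges n e)) + (\<Sum>w\<in>W. mset_set (block_edges n {w}))"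
proof -
  let ?B = "pairs W \<union> (\<lambda>w. {w}) ` W"
  have "mset_set (pairs (W \<times> {..<n})) = (\<Sum>e\<in>?B. mset_set {x \<in> pairs (W \<times> {..<n}). fst ` x = e})"
  proof (intro mset_set_fibers[symmetric] subsetI)
    fix e assume "e \<in> (`) fst ` pairs (W \<times> {..<n})"
    then obtain a b where "e = {a, b}" "a \<in> W" "b \<in> W"
      by (auto simp: pairs_def)
    then show "e \<in> ?B" by (cases "a = b") (auto simp: pairs_def)
  qed (use assms in auto)
  also have "\<dots> = (\<Sum>e\<in>?B. mset_set (block_edges n e))"
    by (intro sum.cong refl arg_cong[of _ _ mset_set] block_edges_eq) (auto simp: pairs_def)
  also have "\<dots> = (\<Sum>e\<in>pairs W. mset_set (block_edges n e)) + (\<Sum>e\<in>(\<lambda>w. {w}) ` W. mset_set (block_edges n e))"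
    using assms by (intro sum.union_disjoint) (auto simp: pairs_eq)
  also have "(\<Sum>e\<in>(\<lambda>w. {w}) ` W. mset_set (block_edges n e)) = (\<Sum>w\<in>W. mset_set (block_edges n {w}))"
    by (subst sum.reindex) auto
  finally show ?thesis .
qed

lemma mset_set_block_edges:
  assumes "a \<noteq> b"
  shows "mset_set (block_edges n {a, b}) = (\<Sum>p<n. \<Sum>q<n. {#{(a, p), (b, q)}#})"
proof -
  let ?f = "\<lambda>(p, q). {(a, p), (b, q)}"
  have inj: "inj_on ?f ({..<n} \<times> {..<n})"
    using assms by (auto simp: inj_on_def doubleton_eq_iff)
  have "?f ` ({..<n} \<times> {..<n}) = block_edges n {a, b}"
  proof
    show "?f ` ({..<n} \<times> {..<n}) \<subseteq> block_edges n {a, b}"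
      using assms unfolding block_edges_def pairs_def by fastforce
    show "block_edges n {a, b} \<subseteq> ?f ` ({..<n} \<times> {..<n})"
    proof
      fix x assume "x \<in> block_edges n {a, b}"
      then obtain c p d q where x: "x = {(c, p), (d, q)}" "p < n" "q < n" "{c, d} = {a, b}"
        by (auto simp: block_edges_def pairs_def)
      then consider "c = a" "d = b" | "c = b" "d = a" by (auto simp: doubleton_eq_iff)
      then show "x \<in> ?f ` ({..<n} \<times> {..<n})"
        using x by cases (auto simp: insert_commute)
    qed
  qed
  with image_mset_mset_set[OF inj] show ?thesis
    unfolding sum.cartesian_product by (simp add: sum_singleton_image case_prod_unfold)
qed

lemma mset_set_pairs_two_blocks:
  assumes "a \<noteq> b"
  shows "mset_set (pairs ({a, b} \<times> {..<n})) =
    mset_set (block_edges n {a, b}) + (mset_set (block_edges n {a}) + mset_set (block_edges n {b}))"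
proof -
  have "pairs {a, b} = {{a, b}}" using assms by (auto simp: pairs_def)
  then show ?thesis using assms by (simp add: mset_set_pairs_times)
qed

lemma mset_set_two_blocks:
  fixes n :: nat
  assumes "a \<noteq> b"
  shows "mset_set ({a, b} \<times> {..<n}) = (\<Sum>j<n. {#(a, j)#}) + (\<Sum>j<n. {#(b, j)#})"
proof -
  have 1: "(\<Sum>j<n. {#(c, j)#}) = mset_set ({c} \<times> {..<n})" for c :: 'a
    by (simp add: sum_singleton_image image_mset_mset_set inj_on_def) (auto intro: arg_cong[of _ _ mset_set])
  have 2: "{a, b} \<times> {..<n} = {a} \<times> {..<n} \<union> {b} \<times> {..<n}" by auto
  show ?thesis
    unfolding 1 2 by (rule mset_set_Union) (use assms in auto)
qed

text \<open>Cycle \<open>d\<close> alternates \<open>(a, j)\<close> and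
  \<open>(b, (j + d) mod n)\<close>. For fixed \<open>j\<close> the index at \<open>b\<close> takes
  every residue as \<open>d\<close> varies, so each of the two edge classes is the whole bipartite
  graph.\<close>

lemma cycle_decomp_bipartite:
  assumes "a \<noteq> b"
  shows "cycle_decomp n 1 (2 * n) ({a, b} \<times> {..<n}) (repeat_mset 2 (mset_set (block_edges n {a, b})))"
proof (rule cycle_decomp_alternate[where f = "\<lambda>d j. (a, j)" and h = "\<lambda>d j. (b, (j + d) mod n)"])
  show "(\<Sum>j<n. {#(a, j)#}) + (\<Sum>j<n. {#(b, (j + d) mod n)#}) = mset_set ({a, b} \<times> {..<n})" for d
    using sum_rotate[of "\<lambda>j. {#(b, j)#}" d n] by (simp add: mset_set_two_blocks assms add.commute)
  show "(\<Sum>d<n. \<Sum>j<n. {#{(a, j), (b, (j + d) mod n)}#}) = mset_set (block_edges n {a, b})"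
    by (subst sum.swap) (simp add: mset_set_block_edges assms sum_rotate[of "\<lambda>q. {#{(a, _), (b, q)}#}"])
  have "(\<Sum>d<n. \<Sum>j<n. {#{(b, (j + d) mod n), (a, Suc j mod n)}#}) =
      (\<Sum>j<n. \<Sum>q<n. {#{(b, q), (a, Suc j mod n)}#})"
    by (subst sum.swap) (simp add: sum_rotate[of "\<lambda>q. {#{(b, q), (a, _)}#}"])
  also have "\<dots> = (\<Sum>p<n. \<Sum>q<n. {#{(b, q), (a, p)}#})"
    using sum_rotate[of "\<lambda>p. \<Sum>q<n. {#{(b, q), (a, p)}#}" 1 n] by simp
  finally show "(\<Sum>d<n. \<Sum>j<n. {#{(b, (j + d) mod n), (a, Suc j mod n)}#}) = mset_set (block_edges n {a, b})"
    by (simp add: mset_set_block_edges assms insert_commute)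
qed

text \<open>The points form \<open>2 * y\<close> blocks of size \<open>n\<close>, labelled by the
  zigzag model for \<open>y\<close>; there the edges \<open>{zig y r s, zag y r s}\<close> with
  fixed \<open>r\<close> form a 1-factor. The construction yields
  \<open>(2 * y - 2) * n + (2 * n - 1)\<close> factors.\<close>

lemma cycle_decomp_multiple:
  assumes "finite V" "card V = 2 * n * y" "n > 0" "y > 0"
  shows "\<exists>N. cycle_decomp N y (2 * n) V (repeat_mset 2 (mset_set (pairs V)))"
proof -
  let ?W = "{0..2 * int y - 1}" and ?a = "zig y" and ?b = "zag y" and ?V = "{0..2 * int y - 1} \<times> {..<n}"
  have ne: "?a r s \<noteq> ?b r s" if "r < 2 * y - 1" "s < y" for r s
  proof -
    have "{?a r s, ?b r s} \<in># (\<Sum>r<2 * y - 1. \<Sum>s<y. {#{?a r s, ?b r s}#})"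
      using that by (auto simp: set_mset_sum)
    then have "{?a r s, ?b r s} \<in> pairs ?W"
      unfolding zig_zag_pairs[OF \<open>y > 0\<close>] by simp
    then show ?thesis by (auto simp: pairs_eq)
  qed
  \<comment> \<open>The ends of the \<open>r\<close>-th 1-factor run once through all labels, so its
    \<open>y\<close> double blocks partition the points.\<close>
  have verts: "(\<Sum>s<y. mset_set ({?a r s, ?b r s} \<times> {..<n})) = mset_set ?V" if "r < 2 * y - 1" for r
  proof -
    have "(\<Sum>s<y. mset_set ({?a r s, ?b r s} \<times> {..<n})) =
        (\<Sum>j<n. \<Sum>s<y. {#(?a r s, j)#}) + (\<Sum>j<n. \<Sum>s<y. {#(?b r s, j)#})"
      using ne[OF that] by (simp add: mset_set_two_blocks sum.distrib sum.swap[of _ "{..<n}"])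
    also have "\<dots> = (\<Sum>j<n. image_mset (\<lambda>w. (w, j)) ((\<Sum>s<y. {#?a r s#}) + (\<Sum>s<y. {#?b r s#})))"
      by (simp add: sum.distrib flip: sum_image_mset)
    also have "\<dots> = (\<Sum>j<n. \<Sum>w\<in>?W. {#(w, j)#})"
      unfolding zigzag_verts[OF \<open>y > 0\<close>] by (simp only: sum_singleton_image)
    also have "\<dots> = (\<Sum>x\<in>?V. {#x#})"
      by (subst sum.swap) (simp only: sum.cartesian_product case_prod_unfold prod.collapse)
    finally show ?thesis by (simp add: sum_singleton_image)
  qed
  have "cycle_decomp n y (2 * n) ?V
      (\<Sum>s<y. repeat_mset 2 (mset_set (block_edges n {?a r s, ?b r s})))" if "r < 2 * y - 1" for r
    by (rule cycle_decomp_parallel[OF cycle_decomp_bipartite[OF ne] verts]) (use that in auto)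
  \<comment> \<open>Only the 1-factors from 1 on are bipartite; 1-factor 0 is reserved for complete
    graphs, which also cover the edges inside blocks.\<close>
  then have 1: "cycle_decomp ((2 * y - 2) * n) y (2 * n) ?V
      (\<Sum>r<2 * y - 2. \<Sum>s<y. repeat_mset 2 (mset_set (block_edges n {?a (Suc r) s, ?b (Suc r) s})))"
    by (intro cycle_decomp_sum) auto
  have 2: "cycle_decomp (2 * n - 1) y (2 * n) ?V
      (\<Sum>s<y. repeat_mset 2 (mset_set (pairs ({?a 0 s, ?b 0 s} \<times> {..<n}))))"
    by (rule cycle_decomp_parallel[OF cycle_decomp_complete verts]) (use assms ne[of 0] in auto)
  let ?B = "\<lambda>e. mset_set (block_edges n e)"
  have y: "2 * y - 1 = Suc (2 * y - 2)" using \<open>y > 0\<close> by simp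
  have "(\<Sum>s<y. mset_set (pairs ({?a 0 s, ?b 0 s} \<times> {..<n}))) =
      (\<Sum>s<y. ?B {?a 0 s, ?b 0 s}) + (\<Sum>s<y. ?B {?a 0 s} + ?B {?b 0 s})"
    using ne[of 0] \<open>y > 0\<close> by (simp add: mset_set_pairs_two_blocks sum.distrib)
  \<comment> \<open>The ends of 1-factor 0 exhaust the labels. The index \<open>i\<close> below 2
    merges the \<open>zig\<close> and \<open>zag\<close> families into one double sum.\<close>
  also have "(\<Sum>s<y. ?B {?a 0 s} + ?B {?b 0 s}) = (\<Sum>w\<in>?W. ?B {w})"
    using zigzag_verts[OF \<open>y > 0\<close>, of 0]
      sum_sum_of_mset_eq[where A = "{..<2::nat}" and B = "{..<y}" and C = ?W and G = "\<lambda>w. ?B {w}"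
        and f = "\<lambda>i s. if i = 0 then ?a 0 s else ?b 0 s"]
    by (simp add: numeral_2_eq_2 sum.distrib)
  finally have "(\<Sum>r<2 * y - 2. \<Sum>s<y. ?B {?a (Suc r) s, ?b (Suc r) s}) +
      (\<Sum>s<y. mset_set (pairs ({?a 0 s, ?b 0 s} \<times> {..<n}))) =
      (\<Sum>r<2 * y - 1. \<Sum>s<y. ?B {?a r s, ?b r s}) + (\<Sum>w\<in>?W. ?B {w})"
    unfolding y sum.lessThan_Suc_shift by (simp add: algebra_simps)
  also have "\<dots> = mset_set (pairs ?V)"
    by (simp only: sum_sum_of_mset_eq[where G = ?B, OF zig_zag_pairs[OF \<open>y > 0\<close>]] mset_set_pairs_times finite_atLeastAtMost_int)
  finally have "(\<Sum>r<2 * y - 2. \<Sum>s<y. repeat_mset 2 (?B {?a (Suc r) s, ?b (Suc r) s})) +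
      (\<Sum>s<y. repeat_mset 2 (mset_set (pairs ({?a 0 s, ?b 0 s} \<times> {..<n})))) =
      repeat_mset 2 (mset_set (pairs ?V))"
    by (simp add: repeat_mset_2 sum.distrib algebra_simps)
  with cycle_decomp_add[OF 1 2] obtain N where
    N: "cycle_decomp N y (2 * n) ?V (repeat_mset 2 (mset_set (pairs ?V)))"
    by auto
  have "card ?V = card V" using assms by (simp add: nat_mult_distrib)
  then obtain f where f: "bij_betw f ?V V"
    using assms(1) by (metis bij_betw_iff_card finite_atLeastAtMost_int finite_SigmaI finite_lessThan)
  from cycle_decomp_image[OF N bij_betw_imp_inj_on[OF f]] show ?thesis
    using f by (auto simp: bij_betw_def image_mset_mset_set inj_on_image_pairs image_pairs repeat_mset_2)
qed

section \<open>Idempotent Latin squares\<close>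

text \<open>On the residues modulo the odd number \<open>m = u - 1\<close>, the midpoint of
  \<open>a\<close> and \<open>b\<close> is an idempotent Latin square. Prolongation gives the even
  order \<open>u\<close>: the entries of a transversal off the diagonal move to a new row and
  column, and the new symbol replaces them.\<close>

lemma idempotent_latin_square:
  fixes u :: nat
  assumes "even u" "u \<ge> 4"
  obtains \<pi> :: "nat \<Rightarrow> nat \<Rightarrow> nat" where
    "\<And>i. i \<in> {1..u} \<Longrightarrow> bij_betw (\<pi> i) ({1..u} - {i}) ({1..u} - {i})"
    "\<And>a. a \<in> {1..u} \<Longrightarrow> bij_betw (\<lambda>i. \<pi> i a) ({1..u} - {a}) ({1..u} - {a})"
proof -
  define m where "m = int u - 1"
  \<comment> \<open>\<open>h\<close> is the inverse of 2 modulo \<open>m\<close>.\<close>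
  define h where "h = int u div 2"
  have h: "2 * h = m + 1" and m: "m \<ge> 3" "0 < h" "h < m"
    using assms by (auto simp: h_def m_def)
  \<comment> \<open>The representatives are 1 to \<open>m\<close>, which leaves
    \<open>u = m + 1\<close> free for the additional point.\<close>
  define \<rho> where "\<rho> z = nat ((z - 1) mod m) + 1" for z
  have \<rho>_range: "1 \<le> \<rho> z" "\<rho> z < u" "\<rho> z \<noteq> u" for z
  proof -
    have "0 \<le> (z - 1) mod m" "(z - 1) mod m < m" using m by auto
    then show "1 \<le> \<rho> z" "\<rho> z < u" "\<rho> z \<noteq> u" unfolding \<rho>_def m_def by linarith+
  qed
  have \<rho>_eq: "\<rho> z = \<rho> w \<longleftrightarrow> m dvd z - w" for z w
    using m by (simp add: \<rho>_def eq_nat_nat_iff mod_eq_dvd_iff)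
  have \<rho>_id: "\<rho> (int a) = a" if "1 \<le> a" "a < u" for a
    using that by (simp add: \<rho>_def m_def)
  have eq_\<rho>: "\<rho> z = a \<longleftrightarrow> m dvd z - int a" if "1 \<le> a" "a < u" for z a
    using \<rho>_eq[of z "int a"] \<rho>_id[OF that] by simp
  have small: "\<not> m dvd z" if "0 < z" "z < m" for z
    using that by (simp add: zdvd_not_zless)
  have dbl: "m dvd z" if "m dvd 2 * z" for z
  proof -
    have "z = h * (2 * z) - m * z" using h by (simp add: algebra_simps) (metis distrib_left mult.assoc mult.commute mult.right_neutral)
    then show ?thesis using that by (metis dvd_diff dvd_mult dvd_triv_left)
  qed
  have eq: "a = b" if "m dvd int a - int b" "1 \<le> a" "a < u" "1 \<le> b" "b < u" for a b
    using that \<rho>_eq \<rho>_id by metis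
  \<comment> \<open>Modulo \<open>m\<close>, \<open>\<pi> i a = b\<close> iff \<open>i\<close> is the midpoint of \<open>a\<close> and \<open>b\<close>, except that the transversal
    \<open>b = a + 1\<close> (with midpoint \<open>a + h\<close>) is given to the additional point \<open>u\<close>.\<close>
  define \<pi> where "\<pi> i a = (if i = u then \<rho> (int a + 1) else if a = u then \<rho> (int i + h)
      else if \<rho> (int a + h) = i then u else \<rho> (2 * int i - int a))" for i a
  show ?thesis
  proof (rule that)
    fix i assume i: "i \<in> {1..u}"
    have "\<pi> i a \<in> {1..u} - {i}" if a: "a \<in> {1..u} - {i}" for a
    proof -
      have "\<rho> (int i + h) \<noteq> i" if "i < u"
        using i that small[of h] m by (simp add: eq_\<rho>)
      moreover have "\<rho> (2 * int i - int a) \<noteq> i" if "i < u" "a < u"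
        using i a that eq[of i a] by (auto simp: eq_\<rho>)
      ultimately show ?thesis
        using i a \<rho>_range by (auto simp: \<pi>_def less_imp_le)
    qed
    moreover have "inj_on (\<pi> i) ({1..u} - {i})"
    proof (rule inj_onI)
      fix a b assume a: "a \<in> {1..u} - {i}" and b: "b \<in> {1..u} - {i}" and ab: "\<pi> i a = \<pi> i b"
      \<comment> \<open>If \<open>u\<close> and \<open>c\<close> had the same image, then
        \<open>i + h\<close> would be congruent to \<open>2 * i - c\<close>, hence
        \<open>c + h\<close> to \<open>i\<close>; but that \<open>c\<close> is sent to
        \<open>u\<close>.\<close>
      have *: False if "i < u" "c < u" "c \<ge> 1" "\<rho> (int c + h) \<noteq> i" "\<rho> (int i + h) = \<rho> (2 * int i - int c)" for c
      proof -
        have "m dvd (int c + h) - int i" using that by (simp add: \<rho>_eq algebra_simps)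
        then show False using that i by (simp add: eq_\<rho>)
      qed
      have **: "c = d" if "1 \<le> c" "1 \<le> d" "c < u" "d < u" "m dvd z" "z = int c - int d \<or> z = int d - int c" for c d z
        using that eq[of c d] eq[of d c] by auto
      show "a = b"
      proof (cases "i = u")
        case True
        then show ?thesis using a b ab **[of a b "int a - int b"] by (auto simp: \<pi>_def \<rho>_eq)
      next
        case False
        then have iu: "i < u" using i by simp
        have ai: "m dvd int a + h - int i" if "a < u" "\<rho> (int a + h) = i"
          using that iu i by (simp add: eq_\<rho>)
        have bi: "m dvd int b + h - int i" if "b < u" "\<rho> (int b + h) = i"
          using that iu i by (simp add: eq_\<rho>)
        consider "a = u" "b = u" | "a = u" "b < u" | "a < u" "b = u" | "a < u" "b < u"
          using a b by force
        then show ?thesis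
        proof cases
          case 2
          then show ?thesis using ab iu b *[of b] \<rho>_range by (auto simp: \<pi>_def split: if_splits)
        next
          case 3
          then show ?thesis using ab iu a *[of a] \<rho>_range(3) by (auto simp: \<pi>_def split: if_splits)
        next
          case 4
          show ?thesis
          proof (cases "\<rho> (int a + h) = i")
            case True
            then have "\<rho> (int b + h) = i" using 4 iu ab \<rho>_range(3) by (auto simp: \<pi>_def split: if_splits)
            with True have "m dvd (int a + h - int i) - (int b + h - int i)"
              by (intro dvd_diff[OF ai bi] 4)
            then show ?thesis using **[of a b] 4 a b by auto
          next
            case False
            then have "\<rho> (int b + h) \<noteq> i" using 4 iu ab \<rho>_range(3) by (auto simp: \<pi>_def split: if_splits)
            then have "\<rho> (2 * int i - int a) = \<rho> (2 * int i - int b)"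
              using False 4 iu ab by (simp add: \<pi>_def)
            then show ?thesis using **[of b a "int b - int a"] 4 a b by (auto simp: \<rho>_eq)
          qed
        qed simp
      qed
    qed
    ultimately show "bij_betw (\<pi> i) ({1..u} - {i}) ({1..u} - {i})"
      by (intro bij_betw_imageI endo_inj_surj) auto
  next
    fix a assume a: "a \<in> {1..u}"
    have "\<pi> i a \<in> {1..u} - {a}" if i: "i \<in> {1..u} - {a}" for i
    proof -
      have "\<rho> (int a + 1) \<noteq> a" if "a < u"
        using a that small[of 1] m by (simp add: eq_\<rho>)
      moreover have "\<rho> (2 * int i - int a) \<noteq> a" if "i < u" "a < u"
        using i a that eq[of i a] dbl[of "int i - int a"] by (auto simp: eq_\<rho> algebra_simps)
      ultimately show ?thesis
        using i a \<rho>_range by (auto simp: \<pi>_def less_imp_le)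
    qed
    moreover have "inj_on (\<lambda>i. \<pi> i a) ({1..u} - {a})"
    proof (rule inj_onI)
      fix i j assume i: "i \<in> {1..u} - {a}" and j: "j \<in> {1..u} - {a}" and ij: "\<pi> i a = \<pi> j a"
      have *: False if "a < u" "c < u" "c \<ge> 1" "\<rho> (int a + h) \<noteq> c" "\<rho> (int a + 1) = \<rho> (2 * int c - int a)" for c
      proof -
        \<comment> \<open>Adding \<open>m = 2 * h - 1\<close> makes the difference even, so 2 can be
          cancelled and \<open>c\<close> is the excluded midpoint \<open>a + h\<close>.\<close>
        have "m dvd (int a + 1 - (2 * int c - int a)) + m" using that by (simp add: \<rho>_eq)
        moreover have "(int a + 1 - (2 * int c - int a)) + m = 2 * (int a + h - int c)" using h by simp
        ultimately have "m dvd 2 * (int a + h - int c)" by (simp only:)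
        then have "m dvd int a + h - int c" by (rule dbl)
        then show False using that by (simp add: eq_\<rho>)
      qed
      show "i = j"
      proof (cases "a = u")
        case True
        then show ?thesis using i j ij eq[of i j] by (auto simp: \<pi>_def \<rho>_eq)
      next
        case False
        then have au: "a < u" using a by simp
        consider "i = u" "j = u" | "i = u" "j < u" | "i < u" "j = u" | "i < u" "j < u"
          using i j by force
        then show ?thesis
        proof cases
          case 2
          then show ?thesis using ij au j *[of j] \<rho>_range by (auto simp: \<pi>_def split: if_splits)
        next
          case 3
          then show ?thesis using ij au i *[of i] \<rho>_range(3) by (auto simp: \<pi>_def split: if_splits)
        next
          case 4
          show ?thesis
          proof (cases "\<rho> (int a + h) = i \<or> \<rho> (int a + h) = j")
            case True
            then show ?thesis using 4 au ij \<rho>_range(3) by (auto simp: \<pi>_def split: if_splits)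
          next
            case False
            then have "\<rho> (2 * int i - int a) = \<rho> (2 * int j - int a)"
              using 4 au ij by (simp add: \<pi>_def)
            then have "m dvd 2 * (int i - int j)" by (simp add: \<rho>_eq algebra_simps)
            then have "m dvd int i - int j" by (rule dbl)
            then show ?thesis using eq[of i j] 4 i j by auto
          qed
        qed simp
      qed
    qed
    ultimately show "bij_betw (\<lambda>i. \<pi> i a) ({1..u} - {a}) ({1..u} - {a})"
      by (intro bij_betw_imageI endo_inj_surj) auto
  qed
qed

section \<open>Lifting to the tensor product\<close>

text \<open>The vertex equation makes \<open>\<psi>\<close> a bijection from index pairs onto
  \<open>V\<close>, so the cycles are disjoint. No edge leaves the vertex set of a cycle, and each
  cycle is connected, so every component is one of the cycles.\<close>

lemma is_cycle_component:
  assumes "finite I" "finite V"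
    and V: "(\<Sum>c\<in>I. \<Sum>j<k. {#\<psi> c j#}) = mset_set V"
    and F: "mverts F = V" "medges F = (\<Sum>c\<in>I. cyc_edges k (\<psi> c))"
    and C: "C \<in> components F"
  shows "is_cycle k C"
proof -
  have "image_mset (\<lambda>(c, j). \<psi> c j) (mset_set (I \<times> {..<k})) = mset_set V"
    using V unfolding sum.cartesian_product sum_singleton_image[symmetric] by (simp add: case_prod_unfold)
  then have im: "(\<lambda>(c, j). \<psi> c j) ` (I \<times> {..<k}) = V" and inj: "inj_on (\<lambda>(c, j). \<psi> c j) (I \<times> {..<k})"
    using assms(1,2) image_mset_eq_mset_setD[of "I \<times> {..<k}" V] by auto
  define A where "A c = \<psi> c ` {..<k}" for c
  have A_V: "A c \<subseteq> V" if "c \<in> I" for c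
    using that im by (auto simp: A_def)
  have disj: "c = d" if "c \<in> I" "d \<in> I" "x \<in> A c" "x \<in> A d" for c d x
    using that inj by (fastforce simp: A_def inj_on_def)
  have inj_\<psi>: "inj_on (\<psi> c) {..<k}" if "c \<in> I" for c
    using that inj by (fastforce simp: inj_on_def)
  have edge_iff: "e \<in># medges F \<longleftrightarrow> (\<exists>c\<in>I. \<exists>j<k. e = {\<psi> c j, \<psi> c (Suc j mod k)})" for e
    using assms(1) by (auto simp: F cyc_edges_def set_mset_sum)
  have edge_A: "\<psi> c j \<in> A c" "\<psi> c (Suc j mod k) \<in> A c" if "j < k" for c j
    using that by (auto simp: A_def)
  let ?R = "{(v, w). {v, w} \<in># medges F}"
  have stay: "w \<in> A c" if "(v, w) \<in> ?R\<^sup>*" "v \<in> A c" "c \<in> I" for v w c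
    using that(1)
  proof induction
    case base
    show ?case using that by simp
  next
    case (step w x)
    then obtain d j where d: "d \<in> I" "j < k" "{w, x} = {\<psi> d j, \<psi> d (Suc j mod k)}"
      by (auto simp: edge_iff)
    then have "{w, x} \<subseteq> A d" using edge_A by simp
    then have "w \<in> A d" "x \<in> A d" by auto
    then show ?case using disj[OF that(3) d(1) step.IH] by simp
  qed
  have reach: "(\<psi> c 0, \<psi> c j) \<in> ?R\<^sup>*" if "j < k" "c \<in> I" for c j
    using that(1)
  proof (induction j)
    case (Suc j)
    then have "{\<psi> c j, \<psi> c (Suc j)} \<in># medges F"
      unfolding edge_iff using that(2) by (metis Suc_lessD mod_less)
    with Suc show ?case by (auto intro: rtrancl.rtrancl_into_rtrancl)
  qed simp
  have "sym ?R" by (auto simp: sym_def insert_commute)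
  then have sym: "sym (?R\<^sup>*)" by (rule sym_rtrancl)
  have conn: "(v, w) \<in> ?R\<^sup>*" if vw: "v \<in> A c" "w \<in> A c" "c \<in> I" for v w c
  proof -
    obtain i j where "v = \<psi> c i" "i < k" "w = \<psi> c j" "j < k"
      using vw by (auto simp: A_def)
    then have "(v, \<psi> c 0) \<in> ?R\<^sup>*" "(\<psi> c 0, w) \<in> ?R\<^sup>*"
      using reach that(3) symD[OF sym] by auto
    then show ?thesis by (rule rtrancl_trans)
  qed
  from C obtain v where v: "v \<in> V" "C = induced_subgraph F (connected_rel F `` {v})"
    by (auto simp: components_def quotient_def F)
  then obtain c where c: "c \<in> I" "v \<in> A c"
    using im by (auto simp: A_def)
  have "connected_rel F `` {v} = A c"
  proof
    show "connected_rel F `` {v} \<subseteq> A c"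
      using stay[OF _ c(2,1)] by (auto simp: connected_rel_def)
    show "A c \<subseteq> connected_rel F `` {v}"
      using conn[OF c(2) _ c(1)] A_V[OF c(1)] v(1) by (auto simp: connected_rel_def F)
  qed
  then have C_eq: "C = induced_subgraph F (A c)" using v by simp
  have "medges C = (\<Sum>d\<in>I. filter_mset (\<lambda>e. e \<subseteq> A c) (cyc_edges k (\<psi> d)))"
    unfolding C_eq induced_subgraph_def using assms(1) by (simp add: F) (induction I rule: finite_induct, auto)
  also have "\<dots> = (\<Sum>d\<in>I. if d = c then cyc_edges k (\<psi> c) else {#})"
  proof (rule sum.cong[OF refl])
    fix d assume d: "d \<in> I"
    have sub: "e \<subseteq> A d \<and> e \<noteq> {}" if "e \<in># cyc_edges k (\<psi> d)" for e
      using that edge_A by (auto simp: cyc_edges_def set_mset_sum)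
    have "\<not> e \<subseteq> A c" if "e \<in># cyc_edges k (\<psi> d)" "d \<noteq> c" for e
      using sub[OF that(1)] disj[OF c(1) d] that(2) by blast
    with sub show "filter_mset (\<lambda>e. e \<subseteq> A c) (cyc_edges k (\<psi> d)) = (if d = c then cyc_edges k (\<psi> c) else {#})"
      by (auto simp: filter_mset_eq_conv)
  qed
  also have "\<dots> = cyc_edges k (\<psi> c)" using assms(1) c by simp
  finally have "medges C = cyc_edges k (\<psi> c)" .
  moreover have "mverts C = A c"
    using A_V[OF c(1)] by (auto simp: C_eq induced_subgraph_def F)
  ultimately show ?thesis
    unfolding is_cycle_def
    by (intro exI[of _ "map (\<psi> c) [0..<k]"])
       (use inj_\<psi>[OF c(1)] in \<open>auto simp: A_def cyc_edges_def distinct_map sum_singleton_image atLeast0LessThan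
          intro!: image_mset_cong\<close>)
qed

section \<open>Edges of the tensor product\<close>

definition tensor_edges :: "'a set \<Rightarrow> 'b set \<Rightarrow> ('a \<times> 'b) set set" where
  "tensor_edges U V = {{(a, p), (b, q)} | a p b q. {a, b} \<in> pairs U \<and> {p, q} \<in> pairs V}"

lemma doubleton_in_pairs: "{a, b} \<in> pairs V \<longleftrightarrow> a \<in> V \<and> b \<in> V \<and> a \<noteq> b"
  by (auto simp: pairs_eq card_2_iff')

lemma finite_tensor_edges: "finite U \<Longrightarrow> finite V \<Longrightarrow> finite (tensor_edges U V)"
  by (rule finite_subset[of _ "pairs (U \<times> V)"]) (auto simp: tensor_edges_def doubleton_in_pairs)

text \<open>For two parts, two edges lie over \<open>{p, q}\<close>, one for each order of the
  parts; hence the sum over ordered pairs.\<close>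

lemma tensor_edges_fiber:
  assumes "finite U" "p \<in> V" "q \<in> V" "p \<noteq> q"
  shows "mset_set {x \<in> tensor_edges U V. snd ` x = {p, q}} =
    (\<Sum>a\<in>U. \<Sum>b\<in>U - {a}. {#{(a, p), (b, q)}#})"
proof -
  let ?f = "\<lambda>(a, b). {(a, p), (b, q)}" and ?D = "SIGMA a:U. U - {a}"
  have "inj_on ?f ?D"
    using assms by (auto simp: inj_on_def doubleton_eq_iff)
  then have "image_mset ?f (mset_set ?D) = mset_set (?f ` ?D)"
    by (rule image_mset_mset_set)
  also have "?f ` ?D = {x \<in> tensor_edges U V. snd ` x = {p, q}}"
  proof
    show "?f ` ?D \<subseteq> {x \<in> tensor_edges U V. snd ` x = {p, q}}"
      using assms by (force simp: tensor_edges_def doubleton_in_pairs)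
    show "{x \<in> tensor_edges U V. snd ` x = {p, q}} \<subseteq> ?f ` ?D"
    proof
      fix x assume "x \<in> {x \<in> tensor_edges U V. snd ` x = {p, q}}"
      then obtain a b p' q' where x: "x = {(a, p'), (b, q')}" "a \<in> U" "b \<in> U" "a \<noteq> b" "{p', q'} = {p, q}"
        by (auto simp: tensor_edges_def doubleton_in_pairs)
      then consider "p' = p" "q' = q" | "p' = q" "q' = p" by (auto simp: doubleton_eq_iff)
      then show "x \<in> ?f ` ?D"
      proof cases
        case 1
        then show ?thesis using x by (intro image_eqI[of _ _ "(a, b)"]) auto
      next
        case 2
        then show ?thesis using x by (intro image_eqI[of _ _ "(b, a)"]) auto
      qed
    qed
  qed
  also have "image_mset ?f (mset_set ?D) = (\<Sum>a\<in>U. \<Sum>b\<in>U - {a}. {#{(a, p), (b, q)}#})"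
    unfolding sum_singleton_image[symmetric] using assms(1) by (subst sum.Sigma) (auto simp: case_prod_unfold)
  finally show ?thesis by simp
qed

lemma medges_KxK: "medges (KxK u g l) = repeat_mset l (mset_set (tensor_edges {1..u} {1..g}))"
  by (simp add: KxK_def edge_multiple_def tensor_product_def complete_graph_def tensor_edges_def pairs_def)

lemma mverts_KxK: "mverts (KxK u g l) = {1..u} \<times> {1..g}"
  by (simp add: KxK_def edge_multiple_def tensor_product_def complete_graph_def)

section \<open>Lifted cycles alternating between two parts\<close>

definition zigzag_lift :: "'a \<Rightarrow> 'a \<Rightarrow> (nat \<Rightarrow> 'b) \<Rightarrow> nat \<Rightarrow> 'a \<times> 'b" where
  "zigzag_lift a b v j = (if even j then a else b, v j)"

lemma cyc_edges_zigzag_lift: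
  assumes "even k"
  shows "cyc_edges k (zigzag_lift a b v) = (\<Sum>j<k. if even j then {#{(a, v j), (b, v (Suc j mod k))}#}
    else {#{(b, v j), (a, v (Suc j mod k))}#})"
proof -
  \<comment> \<open>As \<open>k\<close> is even, reduction modulo \<open>k\<close> keeps parity, so
    the alternation closes up.\<close>
  have "even (Suc j mod k) \<longleftrightarrow> odd j" for j
    using assms by (metis dvd_mod_iff even_Suc)
  then show ?thesis
    unfolding cyc_edges_def by (intro sum.cong) (auto simp: zigzag_lift_def)
qed

text \<open>Even positions contribute \<open>a\<close>, odd ones \<open>\<pi> a\<close>; both run
  over \<open>U\<close>.\<close>

lemma sum_zigzag_lift:
  assumes "bij_betw \<pi> U U"
  shows "(\<Sum>a\<in>U. \<Sum>j<k. {#zigzag_lift a (\<pi> a) v j#}) = (\<Sum>a\<in>U. \<Sum>j<k. {#(a, v j)#})"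
proof -
  have "(\<Sum>a\<in>U. {#zigzag_lift a (\<pi> a) v j#}) = (\<Sum>a\<in>U. {#(a, v j)#})" for j
    using sum.reindex_bij_betw[OF assms, of "\<lambda>a. {#(a, v j)#}"]
    by (cases "even j") (simp_all add: zigzag_lift_def)
  then show ?thesis by (simp add: sum.swap[of _ "{..<k}"])
qed

text \<open>For each step \<open>j\<close> the ordered pairs of distinct parts produce the whole
  fibre over the \<open>j\<close>-th edge of \<open>v\<close>. At odd \<open>j\<close> its ends
  merely change roles.\<close>

lemma sum_cyc_edges_zigzag_lift:
  assumes "finite U" "even k" "\<And>j. j < k \<Longrightarrow> {v j, v (Suc j mod k)} \<in> pairs V"
  shows "(\<Sum>a\<in>U. \<Sum>b\<in>U - {a}. cyc_edges k (zigzag_lift a b v)) =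
    (\<Sum>j<k. mset_set {x \<in> tensor_edges U V. snd ` x = {v j, v (Suc j mod k)}})"
proof -
  have "(\<Sum>a\<in>U. \<Sum>b\<in>U - {a}. cyc_edges k (zigzag_lift a b v)) =
     (\<Sum>j<k. \<Sum>a\<in>U. \<Sum>b\<in>U - {a}. if even j then {#{(a, v j), (b, v (Suc j mod k))}#}
    else {#{(b, v j), (a, v (Suc j mod k))}#})"
    using assms(2) by (simp add: cyc_edges_zigzag_lift sum.swap[of _ "{..<k}"])
  also have "\<dots> = (\<Sum>j<k. mset_set {x \<in> tensor_edges U V. snd ` x = {v j, v (Suc j mod k)}})"
  proof (intro sum.cong refl)
    fix j assume "j \<in> {..<k}"
    then have *: "v j \<in> V" "v (Suc j mod k) \<in> V" "v j \<noteq> v (Suc j mod k)"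
      using assms(3)[of j] by (auto simp: doubleton_in_pairs)
    show "(\<Sum>a\<in>U. \<Sum>b\<in>U - {a}. if even j then {#{(a, v j), (b, v (Suc j mod k))}#}
      else {#{(b, v j), (a, v (Suc j mod k))}#}) =
      mset_set {x \<in> tensor_edges U V. snd ` x = {v j, v (Suc j mod k)}}"
    proof (cases "even j")
      case True
      then show ?thesis using tensor_edges_fiber[OF assms(1) *] by simp
    next
      case False
      then show ?thesis using tensor_edges_fiber[OF assms(1) *(2,1) *(3)[symmetric]]
        by (simp add: insert_commute)
    qed
  qed
  finally show ?thesis .
qed

lemma sum_mset_image_repeat:
  "\<Sum>\<^sub># (image_mset G (repeat_mset l M)) = repeat_mset l (\<Sum>\<^sub># (image_mset G M))"
  by (induction l) auto

text \<open>\<open>perm\<close> makes the lifted cycles of one factor cover every part except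
  \<open>i\<close>. By \<open>row\<close>, the partner \<open>\<pi> i a\<close> of a fixed
  \<open>a\<close> runs once over the other parts as \<open>i\<close> varies, so each tensor edge
  arises as often as its projection, \<open>l\<close> times.\<close>

lemma ARCS_of_cycle_decomp:
  fixes \<pi> :: "nat \<Rightarrow> nat \<Rightarrow> nat"
  assumes D: "cycle_decomp N S k {1..g} (repeat_mset l (mset_set (pairs {1..g})))" and "even k"
    and perm: "\<And>i. i \<in> {1..u} \<Longrightarrow> bij_betw (\<pi> i) ({1..u} - {i}) ({1..u} - {i})"
    and row: "\<And>a. a \<in> {1..u} \<Longrightarrow> bij_betw (\<lambda>i. \<pi> i a) ({1..u} - {a}) ({1..u} - {a})"
  shows "\<exists>\<F>. ARCS k u g l \<F>"
proof -
  let ?U = "{1..u}" and ?V = "{1..g}"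
  obtain \<Phi> where v: "\<And>t. t < N \<Longrightarrow> (\<Sum>s<S. \<Sum>j<k. {#\<Phi> t s j#}) = mset_set ?V"
    and e: "(\<Sum>t<N. \<Sum>s<S. cyc_edges k (\<Phi> t s)) = repeat_mset l (mset_set (pairs ?V))"
    using D by (auto simp: cycle_decomp_def)
  have edge: "{\<Phi> t s j, \<Phi> t s (Suc j mod k)} \<in> pairs ?V" if "t < N" "s < S" "j < k" for t s j
  proof -
    have "{\<Phi> t s j, \<Phi> t s (Suc j mod k)} \<in># (\<Sum>t<N. \<Sum>s<S. cyc_edges k (\<Phi> t s))"
      using that by (auto simp: cyc_edges_def set_mset_sum)
    moreover have "x \<in># M" if "x \<in># repeat_mset l M" for x :: "nat set" and M
      using that by (induction l) auto
    ultimately show ?thesis unfolding e by fastforce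
  qed
  define \<psi> where "\<psi> i t = (\<lambda>(a, s). zigzag_lift a (\<pi> i a) (\<Phi> t s))" for i t
  define F where "F i t = \<lparr>mverts = (?U - {i}) \<times> ?V,
    medges = (\<Sum>c\<in>(?U - {i}) \<times> {..<S}. cyc_edges k (\<psi> i t c))\<rparr>" for i t
  define \<F> where "\<F> = image_mset (\<lambda>(i, t). F i t) (mset_set (?U \<times> {..<N}))"
  have verts: "(\<Sum>c\<in>(?U - {i}) \<times> {..<S}. \<Sum>j<k. {#\<psi> i t c j#}) = mset_set ((?U - {i}) \<times> ?V)"
    if "i \<in> ?U" "t < N" for i t
  proof -
    have "(\<Sum>c\<in>(?U - {i}) \<times> {..<S}. \<Sum>j<k. {#\<psi> i t c j#}) =
        (\<Sum>s<S. \<Sum>a\<in>?U - {i}. \<Sum>j<k. {#zigzag_lift a (\<pi> i a) (\<Phi> t s) j#})"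
      by (simp add: sum.cartesian_product' \<psi>_def) (rule sum.swap)
    also have "\<dots> = (\<Sum>a\<in>?U - {i}. \<Sum>s<S. \<Sum>j<k. {#(a, \<Phi> t s j)#})"
      using perm[OF that(1)] by (subst sum.swap) (simp add: sum_zigzag_lift)
    also have "\<dots> = (\<Sum>a\<in>?U - {i}. image_mset (Pair a) (\<Sum>s<S. \<Sum>j<k. {#\<Phi> t s j#}))"
      by (simp flip: sum_image_mset)
    also have "\<dots> = (\<Sum>a\<in>?U - {i}. \<Sum>p\<in>?V. {#(a, p)#})"
      unfolding v[OF that(2)] by (simp only: sum_singleton_image)
    also have "\<dots> = (\<Sum>x\<in>(?U - {i}) \<times> ?V. {#x#})"
      by (simp only: sum.cartesian_product case_prod_unfold prod.collapse)
    finally show ?thesis by (simp only: sum_singleton_image image_mset.id multiset.map_ident)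
  qed
  have "(\<Sum>F\<in>#\<F>. medges F) = (\<Sum>i\<in>?U. \<Sum>t<N. medges (F i t))"
    unfolding sum.cartesian_product
    by (simp add: \<F>_def sum_unfold_sum_mset case_prod_unfold multiset.map_comp comp_def)
  also have "\<dots> = (\<Sum>i\<in>?U. \<Sum>t<N. \<Sum>a\<in>?U - {i}. \<Sum>s<S. cyc_edges k (zigzag_lift a (\<pi> i a) (\<Phi> t s)))"
    by (simp add: F_def \<psi>_def sum.cartesian_product')
  also have "\<dots> = (\<Sum>t<N. \<Sum>s<S. \<Sum>i\<in>?U. \<Sum>a\<in>?U - {i}. cyc_edges k (zigzag_lift a (\<pi> i a) (\<Phi> t s)))"
    by (subst sum.swap, rule sum.cong[OF refl]) (simp add: sum.swap[of _ "{..<S}"])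
  \<comment> \<open>With \<open>a\<close> as the outer index, \<open>row\<close> permits the
    substitution of \<open>b\<close> for \<open>\<pi> i a\<close>.\<close>
  also have "\<dots> = (\<Sum>t<N. \<Sum>s<S. \<Sum>a\<in>?U. \<Sum>b\<in>?U - {a}. cyc_edges k (zigzag_lift a b (\<Phi> t s)))"
  proof (rule sum.cong[OF refl], rule sum.cong[OF refl])
    fix t s
    have set: "?U - {i} = {a. a \<in> ?U \<and> i \<noteq> a}" "?U - {i} = {a. a \<in> ?U \<and> a \<noteq> i}" for i by auto
    have "(\<Sum>i\<in>?U. \<Sum>a\<in>?U - {i}. cyc_edges k (zigzag_lift a (\<pi> i a) (\<Phi> t s))) =
        (\<Sum>i\<in>?U. \<Sum>a | a \<in> ?U \<and> i \<noteq> a. cyc_edges k (zigzag_lift a (\<pi> i a) (\<Phi> t s)))"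
      unfolding set(1) ..
    also have "\<dots> = (\<Sum>a\<in>?U. \<Sum>i | i \<in> ?U \<and> i \<noteq> a. cyc_edges k (zigzag_lift a (\<pi> i a) (\<Phi> t s)))"
      by (rule sum.swap_restrict) auto
    also have "\<dots> = (\<Sum>a\<in>?U. \<Sum>i\<in>?U - {a}. cyc_edges k (zigzag_lift a (\<pi> i a) (\<Phi> t s)))"
      unfolding set(2) ..
    also have "\<dots> = (\<Sum>a\<in>?U. \<Sum>b\<in>?U - {a}. cyc_edges k (zigzag_lift a b (\<Phi> t s)))"
      by (intro sum.cong refl sum.reindex_bij_betw[OF row])
    finally show "(\<Sum>i\<in>?U. \<Sum>a\<in>?U - {i}. cyc_edges k (zigzag_lift a (\<pi> i a) (\<Phi> t s))) =
        (\<Sum>a\<in>?U. \<Sum>b\<in>?U - {a}. cyc_edges k (zigzag_lift a b (\<Phi> t s)))" .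
  qed
  also have "\<dots> = (\<Sum>t<N. \<Sum>s<S. \<Sum>j<k. mset_set {x \<in> tensor_edges ?U ?V. snd ` x = {\<Phi> t s j, \<Phi> t s (Suc j mod k)}})"
    using edge \<open>even k\<close> by (intro sum.cong[OF refl] sum_cyc_edges_zigzag_lift) auto
  \<comment> \<open>Each base edge contributes its whole fibre, and the fibres over all pairs
    partition the tensor edges.\<close>
  also have "\<dots> = \<Sum>\<^sub># (image_mset (\<lambda>e. mset_set {x \<in> tensor_edges ?U ?V. snd ` x = e})
      (\<Sum>t<N. \<Sum>s<S. cyc_edges k (\<Phi> t s)))"
    by (simp add: cyc_edges_def sum_mset_image_sum)
  also have "\<dots> = repeat_mset l (\<Sum>e\<in>pairs ?V. mset_set {x \<in> tensor_edges ?U ?V. snd ` x = e})"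
    unfolding e by (simp only: sum_mset_image_repeat sum_unfold_sum_mset)
  also have "(\<Sum>e\<in>pairs ?V. mset_set {x \<in> tensor_edges ?U ?V. snd ` x = e}) = mset_set (tensor_edges ?U ?V)"
    by (intro mset_set_fibers finite_tensor_edges finite_pairs) (auto simp: tensor_edges_def)
  finally have total: "(\<Sum>F\<in>#\<F>. medges F) = medges (KxK u g l)"
    by (simp only: medges_KxK)
  have "partial_cycle_factor k u g l (F i t)" if it: "i \<in> ?U" "t < N" for i t
    unfolding partial_cycle_factor_def
  proof (intro bexI[OF _ it(1)] conjI ballI)
    fix C assume "C \<in> components (F i t)"
    with verts[OF it] show "is_cycle k C"
      by (intro is_cycle_component[where I = "(?U - {i}) \<times> {..<S}" and V = "(?U - {i}) \<times> ?V"
          and \<psi> = "\<psi> i t" and F = "F i t"])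
         (auto simp: F_def)
  next
    let ?M = "delete_verts (KxK u g l) (partite_set g i)"
    have W: "?U \<times> ?V - {i} \<times> ?V = (?U - {i}) \<times> ?V" by auto
    have mv: "mverts ?M = mverts (F i t)"
      by (auto simp: delete_verts_def induced_subgraph_def mverts_KxK partite_set_def complete_graph_def F_def)
    have inside: "x \<subseteq> mverts (F i t)" if x: "x \<in># medges (F i t)" for x
    proof -
      obtain c j where c: "c \<in> (?U - {i}) \<times> {..<S}" "j < k" "x = {\<psi> i t c j, \<psi> i t c (Suc j mod k)}"
        using x by (auto simp: F_def cyc_edges_def set_mset_sum)
      have "\<psi> i t c j' \<in># (\<Sum>c\<in>(?U - {i}) \<times> {..<S}. \<Sum>j<k. {#\<psi> i t c j#})" if "j' < k" for j'
        using that c by (auto simp: set_mset_sum)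
      then have "\<psi> i t c j' \<in> (?U - {i}) \<times> ?V" if "j' < k" for j'
        using that unfolding verts[OF it] by simp
      then show ?thesis using c by (simp add: F_def)
    qed
    \<comment> \<open>\<open>F i t\<close> is one summand of the total just computed, which bounds
      its edge multiplicities.\<close>
    have "F i t \<in># \<F>" using it by (auto simp: \<F>_def)
    then have "medges (F i t) \<subseteq># medges (KxK u g l)"
      unfolding total[symmetric] by (metis mset_add image_mset_add_mset sum_mset.insert mset_subset_eq_add_left)
    then have "filter_mset (\<lambda>e. e \<subseteq> mverts (F i t)) (medges (F i t)) \<subseteq># medges ?M"
      using multiset_filter_mono[of "medges (F i t)" "medges (KxK u g l)" "\<lambda>e. e \<subseteq> mverts (F i t)"]
      by (simp add: delete_verts_def induced_subgraph_def mverts_KxK partite_set_def complete_graph_def F_def W[unfolded One_nat_def])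
    moreover have "filter_mset (\<lambda>e. e \<subseteq> mverts (F i t)) (medges (F i t)) = medges (F i t)"
      using inside by (simp add: filter_mset_eq_conv)
    ultimately show "spanning_subgraph (F i t) ?M"
      using inside mv by (simp add: spanning_subgraph_def subgraph_def)
  qed
  then have "\<forall>F\<in>#\<F>. partial_cycle_factor k u g l F"
    by (auto simp: \<F>_def)
  with total show ?thesis unfolding ARCS_def by blast
qed

theorem theorem4p5:
  fixes k x y u g :: nat
  assumes "k > 6" and "even k"
    and "y \<ge> 2"
    and "x > 0" and "x \<noteq> 2"
    and "u = 4 * x" and "g = k * y"
  shows "\<exists>\<F>. ARCS k u g 2 \<F>"
proof -
  obtain n where n: "k = 2 * n" using \<open>even k\<close> by (rule evenE)
  obtain N where "cycle_decomp N y k {1..g} (repeat_mset 2 (mset_set (pairs {1..g})))"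
    using cycle_decomp_multiple[of "{1..g}" n y] assms n by auto
  moreover obtain \<pi> where
    "\<And>i. i \<in> {1..u} \<Longrightarrow> bij_betw (\<pi> i) ({1..u} - {i}) ({1..u} - {i})"
    "\<And>a. a \<in> {1..u} \<Longrightarrow> bij_betw (\<lambda>i. \<pi> i a) ({1..u} - {a}) ({1..u} - {a})"
    using idempotent_latin_square[of u] assms by auto
  ultimately show ?thesis
    using ARCS_of_cycle_decomp \<open>even k\<close> by blast
qed

end
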